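(* Consider a Hamiltonian $H_{\bar i}\in\mathcal A_{\bar i}$ and an initial state $\rho_{\bar i}(t_0)\in\mathcal S(\mathcal H_{\bar i})$. Let $X$ be a bilocal unitary and $g_i,g_j\in\mathcal G$ frame orientations. Then $\rho_{\bar i}(t)\in\mathcal A_{\bar i}^{X}$ for all $t\in[t_0,t_1]$ if and only if the initial state resides in this subalgebra, $\rho_{\bar i}(t_0)\in\mathcal A_{\bar i}^X$, and $$[H_{\bar i}-H_{j\to i},\rho_{\bar i}(t)]=0\qquad\forall\,t\in[t_0,t_1],$$ which is equivalent to $[\hat\Pi_{\bar i}^{X\perp}(H_{\bar i}-H_{j\to i}),\rho_{\bar i}(t)]=0$ for $t\in[t_0,t_1]$.
   Context: $\mathcal G$ is a finite abelian group, $\mathcal G\neq\{e\}$. For $i=1,2$ (two ideal quantum reference frames $R_1,R_2$), $\mathcal H_i=\ell^2(\mathcal G)$ has orthonormal basis $\{|g\rangle_i\}_{g\in\mathcal G}$. $\mathcal H_S$ is a finite-dimensional complex Hilbert space carrying a unitary representation $g\mapsto U_S^g$ of $\mathcal G$. For $i\neq j$ in $\{1,2\}$, $\mathcal H_{\bar i}=\mathcal H_j\otimes\mathcal H_S$ (the description of $R_j$ and $S$ relative to $R_i$), $\mathcal A_{\bar i}=\mathcal L(\mathcal H_{\bar i})$, and $\mathcal S(\cdot)$ denotes density operators. For a unitary $W$ write $\hat W(A)=WAW^\dagger$ and $\hat W^\dagger(A)=W^\dagger AW$. Let $\mathbf U_{\bar i}^{g_i,g_j}=\sum_{g\in\mathcal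 G}|g_ig\rangle\langle g_jg^{-1}|_j\otimes U_S^g$ on $\mathcal H_{\bar i}$. For a bilocal unitary $X=Y_j\otimes Z_S$, $\mathcal A_{\bar i}^{X}=\{f\in\mathcal A_{\bar i}:\hat{\mathbf U}_{\bar i}^{g_i,g_j}(f)=\hat X^\dagger(f)\}$, a unital $*$-subalgebra. $\hat\Pi_{\bar i}^{X}$ is the orthogonal projector (w.r.t. the Hilbert–Schmidt inner product) of $\mathcal A_{\bar i}$ onto $\mathcal A_{\bar i}^X$, and $\hat\Pi_{\bar i}^{X\perp}=\mathrm{id}-\hat\Pi_{\bar i}^{X}$. The Hamiltonian $H_{\bar i}$ is self-adjoint and time-independent and $\rho_{\bar i}(t)=e^{-iH_{\bar i}(t-t_0)}\rho_{\bar i}(t_0)e^{iH_{\bar i}(t-t_0)}$ (the $i$ in the exponents being the imaginary unit). The imported Hamiltonian is $H_{j\to i}=\hat X\hat{\mathbf U}_{\bar i}^{g_i,g_j}(H_{\bar i})$. *)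

theory Defs
  imports "HOL-Analysis.Analysis"
begin

text \<open>
  A finite-dimensional complex Hilbert space with a chosen orthonormal basis indexed by a finite
  type \<open>'n\<close> is \<open>complex ^ 'n\<close>, and its operators are square matrices multiplied with \<open>**\<close>.
  The type class operations \<open>*\<close>, \<open>1\<close> and \<open>^\<close> act componentwise on \<open>vec\<close>, and \<open>exp\<close> is not
  available there, hence \<open>op_power\<close> and \<open>op_exp\<close> below.
\<close>

type_synonym 'n op = "complex ^ 'n ^ 'n"

definition dagger :: "'n::finite op \<Rightarrow> 'n op" where
  "dagger A = transpose (map_matrix cnj A)"

definition cscale :: "complex \<Rightarrow> 'n::finite op \<Rightarrow> 'n op" where
  "cscale c A = map_matrix ((*) c) A"

definition unitary_op :: "'n::finite op \<Rightarrow> bool" where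
  "unitary_op W \<longleftrightarrow> dagger W ** W = mat 1 \<and> W ** dagger W = mat 1"

definition self_adjoint :: "'n::finite op \<Rightarrow> bool" where
  "self_adjoint A \<longleftrightarrow> dagger A = A"

definition cip :: "complex ^ 'n::finite \<Rightarrow> complex ^ 'n \<Rightarrow> complex" where
  "cip v w = (\<Sum>k\<in>UNIV. cnj (v $ k) * w $ k)"

text \<open>For self-adjoint \<open>A\<close> the number \<open>cip v (A *v v)\<close> is real, so the use of \<open>Re\<close> loses nothing.\<close>

definition density_op :: "'n::finite op \<Rightarrow> bool" where
  "density_op \<rho> \<longleftrightarrow>
     self_adjoint \<rho> \<and> (\<forall>v. 0 \<le> Re (cip v (\<rho> *v v))) \<and> trace \<rho> = 1"

definition hs_inner :: "'n::finite op \<Rightarrow> 'n op \<Rightarrow> complex" where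
  "hs_inner A B = trace (dagger A ** B)"

definition commutator :: "'n::finite op \<Rightarrow> 'n op \<Rightarrow> 'n op" where
  "commutator A B = A ** B - B ** A"

primrec op_power :: "'n::finite op \<Rightarrow> nat \<Rightarrow> 'n op" where
  "op_power A 0 = mat 1"
| "op_power A (Suc n) = A ** op_power A n"

definition op_exp :: "'n::finite op \<Rightarrow> 'n op" where
  "op_exp A = (\<Sum>n. (1 / fact n) *\<^sub>R op_power A n)"

definition hat :: "'n::finite op \<Rightarrow> 'n op \<Rightarrow> 'n op" where
  "hat W A = W ** A ** dagger W"

definition hat_dag :: "'n::finite op \<Rightarrow> 'n op \<Rightarrow> 'n op" where
  "hat_dag W A = dagger W ** A ** W"

text \<open>Orthogonal projection onto a linear subspace of operators, for the Hilbert--Schmidt inner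
  product. The described operator exists and is unique whenever \<open>S\<close> is a complex linear subspace.\<close>

definition hs_proj :: "'n::finite op set \<Rightarrow> 'n op \<Rightarrow> 'n op" where
  "hs_proj S f = (THE p. p \<in> S \<and> (\<forall>a\<in>S. hs_inner a (f - p) = 0))"

text \<open>The space \<open>\<H>\<^sub>1 \<otimes> \<H>\<^sub>2\<close> has the product basis, indexed by \<open>'m \<times> 'n\<close>.\<close>

definition tensor_op :: "'m::finite op \<Rightarrow> 'n::finite op \<Rightarrow> ('m \<times> 'n) op" where
  "tensor_op A B = (\<chi> p q. A $ fst p $ fst q * B $ snd p $ snd q)"

definition ket_bra :: "'n::finite \<Rightarrow> 'n \<Rightarrow> 'n op" where
  "ket_bra a b = (\<chi> k l. if k = a \<and> l = b then 1 else 0)"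


text \<open>
  The finite abelian group is a type \<open>'g\<close> of class \<open>{finite, ab_group_add}\<close>, written additively:
  \<open>g h\<close>, \<open>g\<^sup>-\<^sup>1\<close> and \<open>e\<close> become \<open>g + h\<close>, \<open>- g\<close> and \<open>0\<close>.
  The frame space \<open>\<ell>\<^sup>2(\<G>)\<close> is \<open>complex ^ 'g\<close>, the system space is \<open>complex ^ 's\<close>, and the
  description of frame \<open>j\<close> and the system relative to frame \<open>i\<close> lives on \<open>complex ^ ('g \<times> 's)\<close>.
  Both frame spaces are copies of \<open>\<ell>\<^sup>2(\<G>)\<close>, so the same definitions serve either choice of \<open>i\<close>.
\<close>

definition unitary_rep :: "('g::{finite, ab_group_add} \<Rightarrow> 's::finite op) \<Rightarrow> bool" where
  "unitary_rep U \<longleftrightarrow>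
     U 0 = mat 1 \<and> (\<forall>g h. U (g + h) = U g ** U h) \<and> (\<forall>g. unitary_op (U g))"

definition frame_change ::
  "('g::{finite, ab_group_add} \<Rightarrow> 's::finite op) \<Rightarrow> 'g \<Rightarrow> 'g \<Rightarrow> ('g \<times> 's) op" where
  "frame_change U gi gj = (\<Sum>g\<in>UNIV. tensor_op (ket_bra (gi + g) (gj - g)) (U g))"

definition bilocal_unitary :: "('g::finite \<times> 's::finite) op \<Rightarrow> bool" where
  "bilocal_unitary X \<longleftrightarrow> (\<exists>Y Z. unitary_op Y \<and> unitary_op Z \<and> X = tensor_op Y Z)"

definition subalg ::
  "('g::{finite, ab_group_add} \<Rightarrow> 's::finite op) \<Rightarrow> 'g \<Rightarrow> 'g \<Rightarrow> ('g \<times> 's) op \<Rightarrow> ('g \<times> 's) op set"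
  where
  "subalg U gi gj X = {f. hat (frame_change U gi gj) f = hat_dag X f}"

definition proj_subalg ::
  "('g::{finite, ab_group_add} \<Rightarrow> 's::finite op) \<Rightarrow> 'g \<Rightarrow> 'g \<Rightarrow> ('g \<times> 's) op
     \<Rightarrow> ('g \<times> 's) op \<Rightarrow> ('g \<times> 's) op" where
  "proj_subalg U gi gj X = hs_proj (subalg U gi gj X)"

definition proj_perp ::
  "('g::{finite, ab_group_add} \<Rightarrow> 's::finite op) \<Rightarrow> 'g \<Rightarrow> 'g \<Rightarrow> ('g \<times> 's) op
     \<Rightarrow> ('g \<times> 's) op \<Rightarrow> ('g \<times> 's) op" where
  "proj_perp U gi gj X f = f - proj_subalg U gi gj X f"

definition imported ::
  "('g::{finite, ab_group_add} \<Rightarrow> 's::finite op) \<Rightarrow> 'g \<Rightarrow> 'g \<Rightarrow> ('g \<times> 's) op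
     \<Rightarrow> ('g \<times> 's) op \<Rightarrow> ('g \<times> 's) op" where
  "imported U gi gj X H = hat X (hat (frame_change U gi gj) H)"

definition evolved :: "'n::finite op \<Rightarrow> 'n op \<Rightarrow> real \<Rightarrow> real \<Rightarrow> 'n op" where
  "evolved H \<rho>0 t0 t =
     op_exp (cscale (- \<i> * of_real (t - t0)) H) ** \<rho>0 ** op_exp (cscale (\<i> * of_real (t - t0)) H)"

end

theory Submission
  imports Defs
begin

section \<open>Algebra of operators\<close>

text \<open>Put \<open>W = X ** frame_change U gi gj\<close>. It is unitary
  (\<open>unitary_frame_change\<close>), the subalgebra is the fixed-point set of
  \<open>hat W\<close> (\<open>subalg_iff\<close>), and the imported Hamiltonian is
  \<open>hat W H\<close>. So the question is when \<open>hat W\<close> fixes a solution of \<rho>' =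
  [B, \<rho>] with B = -iH.

  If it fixes \<rho>(t) throughout, differentiating this identity gives [B, \<rho>] =
  [\<open>hat W B\<close>, \<rho>]. Conversely, this equality makes \<rho> a solution of the
  equation generated by \<open>hat W B\<close>; if \<rho>(t0) is fixed, \<open>hat W\<close> applied
  to \<rho> solves the same initial value problem, and uniqueness (\<open>flow_unique\<close>)
  identifies the two. Both directions are in \<open>flow_invariant_iff\<close>.

  The second equivalence holds because \<open>H - hat W H\<close> is Hilbert-Schmidt orthogonal to
  the fixed points of the isometry \<open>hat W\<close>, so the complementary projection leaves it
  unchanged (\<open>proj_perp_imported\<close>).\<close>

lemma bounded_bilinear_matrix_mult:
  "bounded_bilinear ((**) :: 'n::finite op \<Rightarrow> 'n op \<Rightarrow> 'n op)"
  unfolding bilinear_conv_bounded_bilinear[symmetric] bilinear_def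
  by (auto intro!: linearI simp: matrix_matrix_mult_def vec_eq_iff scaleR_sum_right
        sum.distrib algebra_simps)

interpretation mm: bounded_bilinear "(**) :: 'n::finite op \<Rightarrow> 'n op \<Rightarrow> 'n op"
  by (rule bounded_bilinear_matrix_mult)

lemma dagger_mult: "dagger (A ** B) = dagger B ** dagger A"
  by (simp add: dagger_def vec_eq_iff transpose_def matrix_matrix_mult_def map_matrix_def mult.commute)

lemma dagger_dagger [simp]: "dagger (dagger A) = A"
  by (simp add: dagger_def vec_eq_iff transpose_def map_matrix_def)

lemma dagger_sum: "dagger (\<Sum>x\<in>S. f x) = (\<Sum>x\<in>S. dagger (f x))"
  by (simp add: dagger_def vec_eq_iff transpose_def map_matrix_def)

text \<open>In finite dimension a left inverse is also a right inverse.\<close>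

lemma unitary_opI:
  assumes "dagger W ** W = mat 1"
  shows "unitary_op W"
  using assms matrix_left_right_inverse unfolding unitary_op_def by blast

lemma unitary_op_mult:
  assumes "unitary_op V" "unitary_op W"
  shows "unitary_op (V ** W)"
proof (rule unitary_opI)
  have "dagger (V ** W) ** (V ** W) = dagger W ** (dagger V ** V) ** W"
    by (simp add: dagger_mult matrix_mul_assoc)
  then show "dagger (V ** W) ** (V ** W) = mat 1"
    using assms by (simp add: unitary_op_def)
qed

lemma hat_hat: "hat V (hat W A) = hat (V ** W) A"
  by (simp add: hat_def dagger_mult matrix_mul_assoc)

lemma hat_mult:
  assumes "unitary_op W"
  shows "hat W (A ** B) = hat W A ** hat W B"
proof -
  have W: "dagger W ** W = mat 1"
    using assms by (simp add: unitary_op_def)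
  have "hat W A ** hat W B = W ** A ** (dagger W ** W) ** B ** dagger W"
    by (simp add: hat_def matrix_mul_assoc)
  then show ?thesis
    by (simp add: W) (simp add: hat_def matrix_mul_assoc)
qed

lemma hat_mat_1: "unitary_op W \<Longrightarrow> hat W (mat 1) = mat 1"
  by (simp add: hat_def unitary_op_def)

lemma bounded_linear_hat: "bounded_linear (hat W)"
  unfolding hat_def
  by (intro bounded_linear_compose[OF mm.bounded_linear_left mm.bounded_linear_right])

lemmas hat_diff = linear_diff[OF bounded_linear.linear[OF bounded_linear_hat]]
  and hat_minus = linear_neg[OF bounded_linear.linear[OF bounded_linear_hat]]
  and hat_scaleR = linear_scale[OF bounded_linear.linear[OF bounded_linear_hat]]

lemma hat_commutator:
  "unitary_op W \<Longrightarrow> hat W (commutator A B) = commutator (hat W A) (hat W B)"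
  by (simp add: commutator_def hat_diff hat_mult)

lemma commutator_diff_eq_0_iff:
  "commutator (A - B) C = 0 \<longleftrightarrow> commutator A C = commutator B C"
  by (auto simp: commutator_def mm.diff_left mm.diff_right algebra_simps)

lemma cscale_mult_left: "cscale c A ** B = cscale c (A ** B)"
  by (simp add: cscale_def vec_eq_iff matrix_matrix_mult_def map_matrix_def sum_distrib_left mult.assoc)

lemma cscale_mult_right: "A ** cscale c B = cscale c (A ** B)"
  by (simp add: cscale_def vec_eq_iff matrix_matrix_mult_def map_matrix_def sum_distrib_left
      mult.left_commute)

lemma cscale_diff: "cscale c (A - B) = cscale c A - cscale c B"
  by (simp add: cscale_def vec_eq_iff map_matrix_def right_diff_distrib)

lemma cscale_eq_0_iff: "c \<noteq> 0 \<Longrightarrow> cscale c A = 0 \<longleftrightarrow> A = 0"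
  by (simp add: cscale_def vec_eq_iff map_matrix_def)

lemma hat_cscale: "hat W (cscale c A) = cscale c (hat W A)"
  by (simp add: hat_def cscale_mult_left cscale_mult_right)

lemma commutator_cscale: "commutator (cscale c A) B = cscale c (commutator A B)"
  by (simp add: commutator_def cscale_mult_left cscale_mult_right cscale_diff)

section \<open>The exponential of an operator\<close>

lemma op_power_scaleR: "op_power (t *\<^sub>R A) n = t ^ n *\<^sub>R op_power A n"
  by (induction n) (simp_all add: mm.scaleR_left mm.scaleR_right)

lemma op_power_commute: "A ** op_power A n = op_power A n ** A"
  by (induction n) (simp_all, metis matrix_mul_assoc)

lemma op_power_hat: "unitary_op W \<Longrightarrow> op_power (hat W A) n = hat W (op_power A n)"
  by (induction n) (simp_all add: hat_mat_1 hat_mult)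

lemma summable_op_exp:
  fixes A :: "'n::finite op"
  shows "summable (\<lambda>n. (1 / fact n) *\<^sub>R op_power A n)"
proof -
  \<comment> \<open>The constant comes from boundedness of the bilinear product and stands in for
    submultiplicativity of the norm; the terms are then dominated by an exponential series in
    \<open>norm A * K\<close>.\<close>
  obtain K where K: "0 \<le> K" "\<forall>(A :: 'n op) (B :: 'n op). norm (A ** B) \<le> norm A * norm B * K"
    using mm.nonneg_bounded by blast
  have bound: "norm (op_power A n) \<le> norm (mat 1 :: 'n op) * (norm A * K) ^ n" for n
  proof (induction n)
    case (Suc n)
    have "norm (op_power A (Suc n)) \<le> norm A * norm (op_power A n) * K"
      using K(2) by simp
    also have "\<dots> \<le> norm A * (norm (mat 1 :: 'n op) * (norm A * K) ^ n) * K"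
      by (intro mult_right_mono mult_left_mono Suc.IH K(1)) simp
    finally show ?case by (simp add: mult_ac)
  qed simp
  show ?thesis
  proof (rule summable_comparison_test')
    show "summable (\<lambda>n. norm (mat 1 :: 'n op) * (inverse (fact n) * (norm A * K) ^ n))"
      by (intro summable_mult summable_exp)
    show "norm ((1 / fact n) *\<^sub>R op_power A n)
        \<le> norm (mat 1 :: 'n op) * (inverse (fact n) * (norm A * K) ^ n)" if "n \<ge> 0" for n
      using mult_left_mono[OF bound[of n], of "inverse (fact n)"]
      by (simp add: divide_inverse mult_ac)
  qed
qed

lemma op_exp_0 [simp]: "op_exp (0 :: 'n::finite op) = mat 1"
proof -
  have "op_power (0 :: 'n op) n = (if n = 0 then mat 1 else 0)" for n
    by (cases n) (auto simp: mm.zero_left)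
  then show ?thesis
    unfolding op_exp_def by (subst suminf_finite[where N = "{0}"]) auto
qed

lemma op_exp_mult_commute: "A ** op_exp A = op_exp A ** A"
  unfolding op_exp_def
  by (simp add: bounded_linear.suminf[OF mm.bounded_linear_left summable_op_exp]
      bounded_linear.suminf[OF mm.bounded_linear_right summable_op_exp]
      mm.scaleR_left mm.scaleR_right op_power_commute)

lemma op_exp_scaleR_commute: "A ** op_exp (t *\<^sub>R A) = op_exp (t *\<^sub>R A) ** A"
proof (cases "t = 0")
  case False
  have "t *\<^sub>R (A ** op_exp (t *\<^sub>R A)) = t *\<^sub>R (op_exp (t *\<^sub>R A) ** A)"
    using op_exp_mult_commute[of "t *\<^sub>R A"] by (simp add: mm.scaleR_left mm.scaleR_right)
  with False show ?thesis by simp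
qed simp

lemma op_exp_hat:
  assumes "unitary_op W"
  shows "op_exp (hat W A) = hat W (op_exp A)"
  unfolding op_exp_def
  by (simp add: bounded_linear.suminf[OF bounded_linear_hat summable_op_exp] hat_scaleR
      op_power_hat[OF assms])

text \<open>Each real coordinate of \<open>op_exp (t *\<^sub>R A)\<close> is a power series in \<open>t\<close>, to which
  termwise differentiation of real power series applies.\<close>

lemma op_exp_has_vector_derivative:
  "((\<lambda>t. op_exp (t *\<^sub>R A)) has_vector_derivative A ** op_exp (t *\<^sub>R A)) (at t within S)"
proof -
  have "((\<lambda>t. op_exp (t *\<^sub>R A) \<bullet> b) has_derivative (\<lambda>h. (h *\<^sub>R (A ** op_exp (t *\<^sub>R A))) \<bullet> b))
      (at t within S)" for b
  proof -
    let ?c = "\<lambda>n. (1 / fact n) * (op_power A n \<bullet> b)"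
    have term_eq: "((1 / fact n) *\<^sub>R op_power (t *\<^sub>R A) n) \<bullet> b = ?c n * t ^ n" for t n
      by (simp add: op_power_scaleR)
    have sm: "summable (\<lambda>n. ?c n * t ^ n)" for t
      using bounded_linear.summable[OF bounded_linear_inner_left summable_op_exp[of "t *\<^sub>R A"], of b]
      by (simp only: term_eq)
    have eq: "op_exp (t *\<^sub>R A) \<bullet> b = (\<Sum>n. ?c n * t ^ n)" for t
      unfolding op_exp_def
        bounded_linear.suminf[OF bounded_linear_inner_left summable_op_exp] term_eq ..
    \<comment> \<open>\<open>diffs\<close> shifts the index: (n+1) c_(n+1) = (1/n!) (A^(n+1)
      \<bullet> b), which is the coefficient produced by an extra factor \<open>A\<close> on the
      left.\<close>
    have diffs_eq: "((1 / fact n) *\<^sub>R (A ** op_power (t *\<^sub>R A) n)) \<bullet> b = diffs ?c n * t ^ n" for n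
      by (simp add: op_power_scaleR mm.scaleR_right diffs_def field_simps del: of_nat_Suc)
    have "(A ** op_exp (t *\<^sub>R A)) \<bullet> b = (\<Sum>n. diffs ?c n * t ^ n)"
      unfolding op_exp_def bounded_linear.suminf[OF mm.bounded_linear_right summable_op_exp]
        mm.scaleR_right
      by (subst bounded_linear.suminf[OF bounded_linear_inner_left])
        (use bounded_linear.summable[OF mm.bounded_linear_right summable_op_exp, of A "t *\<^sub>R A"]
          in \<open>simp_all only: mm.scaleR_right diffs_eq\<close>)
    moreover have "((\<lambda>t. \<Sum>n. ?c n * t ^ n) has_field_derivative (\<Sum>n. diffs ?c n * t ^ n)) (at t)"
      by (rule termdiffs_strong_converges_everywhere) (rule sm)
    ultimately have "((\<lambda>t. op_exp (t *\<^sub>R A) \<bullet> b) has_field_derivative (A ** op_exp (t *\<^sub>R A)) \<bullet> b)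
        (at t within S)"
      by (simp only: eq has_field_derivative_at_within)
    then show ?thesis
      by (simp only: has_field_derivative_def inner_scaleR_left mult_commute_abs)
  qed
  then show ?thesis
    unfolding has_vector_derivative_def
    by (subst has_derivative_componentwise_within) blast
qed

lemma op_exp_shift_has_vector_derivative:
  "((\<lambda>t. op_exp ((t - t0) *\<^sub>R A)) has_vector_derivative A ** op_exp ((t - t0) *\<^sub>R A))
     (at t within S)"
proof -
  have "((\<lambda>t. t - t0) has_vector_derivative 1) (at t within S)"
    by (auto intro!: derivative_eq_intros)
  from vector_diff_chain_within[OF this op_exp_has_vector_derivative]
  show ?thesis by (simp add: o_def)
qed

text \<open>The product of exp(tA) and exp(-tA) has zero derivative in t, so its values at 1 and 0
  agree. No product of series has to be computed.\<close>

lemma op_exp_minus_inverse: "op_exp A ** op_exp (- A) = mat 1"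
proof -
  let ?f = "\<lambda>t::real. op_exp (t *\<^sub>R A) ** op_exp (t *\<^sub>R - A)"
  have "(?f has_vector_derivative 0) (at t within UNIV)" for t
  proof -
    have "(?f has_vector_derivative (op_exp (t *\<^sub>R A) ** (- A ** op_exp (t *\<^sub>R - A))
        + (A ** op_exp (t *\<^sub>R A)) ** op_exp (t *\<^sub>R - A))) (at t within UNIV)"
      by (rule mm.has_vector_derivative[OF op_exp_has_vector_derivative op_exp_has_vector_derivative])
    then show ?thesis
      by (simp only: op_exp_scaleR_commute[of A t] mm.minus_left mm.minus_right matrix_mul_assoc
          add.left_inverse)
  qed
  then obtain c where c: "\<And>t. ?f t = c"
    using has_vector_derivative_zero_constant[of UNIV ?f] by auto
  have "?f 1 = ?f 0" by (simp only: c)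
  then show ?thesis by simp
qed

section \<open>Unitary flows\<close>

text \<open>The factor -i is absorbed into the generator \<open>B\<close>, so the parameter is real
  and the derivative is simply \<open>commutator B\<close>.\<close>

definition flow :: "'n::finite op \<Rightarrow> 'n op \<Rightarrow> real \<Rightarrow> 'n op" where
  "flow B R s = op_exp (s *\<^sub>R B) ** R ** op_exp (s *\<^sub>R - B)"

lemma flow_0 [simp]: "flow B R 0 = R"
  by (simp add: flow_def)

lemma hat_flow:
  assumes "unitary_op W"
  shows "hat W (flow B R s) = flow (hat W B) (hat W R) s"
  by (simp add: flow_def hat_mult[OF assms] op_exp_hat[OF assms, symmetric] hat_scaleR hat_minus)

lemma flow_has_vector_derivative:
  "((\<lambda>t. flow B R (t - t0)) has_vector_derivative commutator B (flow B R (t - t0))) (at t within S)"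
proof -
  let ?E = "\<lambda>t. op_exp ((t - t0) *\<^sub>R B)" and ?F = "\<lambda>t. op_exp ((t - t0) *\<^sub>R - B)"
  have "((\<lambda>t. ?E t ** R ** ?F t) has_vector_derivative
      (?E t ** R) ** (- B ** ?F t) + ((B ** ?E t) ** R) ** ?F t) (at t within S)"
    by (intro mm.has_vector_derivative op_exp_shift_has_vector_derivative
        bounded_linear.has_vector_derivative[OF mm.bounded_linear_left])
  moreover have "(?E t ** R) ** (- B ** ?F t) + ((B ** ?E t) ** R) ** ?F t
      = commutator B (?E t ** R ** ?F t)"
    \<comment> \<open>Moving \<open>- B\<close> to the right of its own exponential turns the
      product rule into a commutator.\<close>
    by (simp only: op_exp_scaleR_commute[of "- B"])
      (simp add: commutator_def mm.minus_left mm.minus_right matrix_mul_assoc)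
  ultimately show ?thesis
    by (simp only: flow_def)
qed

text \<open>Integrating factor: conjugating a solution back by the exponentials of \<open>C\<close>
  gives a function with zero derivative, hence a constant.\<close>

lemma flow_unique:
  assumes deriv: "\<And>t. t \<in> {t0..t1} \<Longrightarrow>
      (f has_vector_derivative commutator C (f t)) (at t within {t0..t1})"
    and t: "t \<in> {t0..t1}"
  shows "f t = flow C (f t0) (t - t0)"
proof -
  let ?E = "\<lambda>t. op_exp ((t - t0) *\<^sub>R C)" and ?F = "\<lambda>t. op_exp ((t - t0) *\<^sub>R - C)"
  let ?G = "\<lambda>t. ?F t ** f t ** ?E t"
  have "(?G has_vector_derivative 0) (at s within {t0..t1})" if s: "s \<in> {t0..t1}" for s
  proof -
    have "(?G has_vector_derivative
        (?F s ** f s) ** (C ** ?E s) + (?F s ** commutator C (f s) + (- C ** ?F s) ** f s) ** ?E s)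
        (at s within {t0..t1})"
      by (intro mm.has_vector_derivative op_exp_shift_has_vector_derivative deriv s)
    moreover have "(?F s ** f s) ** (C ** ?E s)
        + (?F s ** commutator C (f s) + (- C ** ?F s) ** f s) ** ?E s = 0"
      by (simp only: op_exp_scaleR_commute[of "- C"])
        (simp add: commutator_def mm.minus_left mm.minus_right mm.diff_left mm.diff_right
          mm.add_left matrix_mul_assoc)
    ultimately show ?thesis by simp
  qed
  then obtain c where c: "\<And>s. s \<in> {t0..t1} \<Longrightarrow> ?G s = c"
    using has_vector_derivative_zero_constant[of "{t0..t1}" ?G] by auto
  have inv: "?E t ** ?F t = mat 1"
    using op_exp_minus_inverse[of "(t - t0) *\<^sub>R C"] by simp
  have "t0 \<in> {t0..t1}" using t by simp
  then have "?G t = ?G t0" by (simp only: c[OF t] c)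
  then have G: "?F t ** f t ** ?E t = f t0" by simp
  have "flow C (f t0) (t - t0) = (?E t ** ?F t) ** f t ** (?E t ** ?F t)"
    unfolding flow_def G[symmetric] by (simp only: matrix_mul_assoc)
  then show ?thesis by (simp only: inv matrix_mul_lid matrix_mul_rid)
qed

text \<open>Differentiating the invariance of the flow under \<open>hat W\<close> gives the commutator condition.
  Conversely, this condition says that the flow also solves the equation generated by
  \<open>hat W B\<close>, whose solution with the same initial value is the conjugate of the flow.\<close>

lemma flow_invariant_iff:
  assumes W: "unitary_op W" and "t0 < t1"
  shows "(\<forall>t\<in>{t0..t1}. hat W (flow B R (t - t0)) = flow B R (t - t0)) \<longleftrightarrow>
    hat W R = R \<and> (\<forall>t\<in>{t0..t1}. commutator (B - hat W B) (flow B R (t - t0)) = 0)"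
    (is "?L \<longleftrightarrow> ?R")
proof
  assume L: ?L
  have "commutator B (flow B R (t - t0)) = commutator (hat W B) (flow B R (t - t0))"
    if t: "t \<in> {t0..t1}" for t
  proof -
    have "((\<lambda>t. hat W (flow B R (t - t0))) has_vector_derivative
        hat W (commutator B (flow B R (t - t0)))) (at t within {t0..t1})"
      by (rule bounded_linear.has_vector_derivative[OF bounded_linear_hat flow_has_vector_derivative])
    then have "((\<lambda>t. flow B R (t - t0)) has_vector_derivative
        hat W (commutator B (flow B R (t - t0)))) (at t within {t0..t1})"
      by (rule has_vector_derivative_transform[OF t, rotated]) (use L in auto)
    \<comment> \<open>The derivative is one-sided at the endpoints; it is unique within the interval
      because \<open>t0 < t1\<close>.\<close>
    then have "commutator B (flow B R (t - t0)) = hat W (commutator B (flow B R (t - t0)))"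
      using vector_derivative_unique_within_closed_interval[OF \<open>t0 < t1\<close>]
        flow_has_vector_derivative t unfolding cbox_interval by blast
    then show ?thesis using L t by (simp add: hat_commutator[OF W])
  qed
  moreover have "hat W R = R" using bspec[OF L, of t0] \<open>t0 < t1\<close> by simp
  ultimately show ?R by (simp add: commutator_diff_eq_0_iff)
next
  assume R: ?R
  show ?L
  proof
    fix t assume t: "t \<in> {t0..t1}"
    \<comment> \<open>The commutator condition permits replacing the generator \<open>B\<close> by
      \<open>hat W B\<close> along this trajectory.\<close>
    have "((\<lambda>t. flow B R (t - t0)) has_vector_derivative
        commutator (hat W B) (flow B R (s - t0))) (at s within {t0..t1})" if "s \<in> {t0..t1}" for s
      using flow_has_vector_derivative[of B R t0 s "{t0..t1}"] R that
      by (simp add: commutator_diff_eq_0_iff)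
    from flow_unique[OF this t]
    have "flow B R (t - t0) = flow (hat W B) R (t - t0)"
      by simp
    also have "\<dots> = hat W (flow B R (t - t0))"
      using R by (simp add: hat_flow[OF W])
    finally show "hat W (flow B R (t - t0)) = flow B R (t - t0)" by (rule sym)
  qed
qed

lemma evolved_eq_flow: "evolved H \<rho>0 t0 t = flow (cscale (- \<i>) H) \<rho>0 (t - t0)"
proof -
  have "cscale (- \<i> * of_real s) H = s *\<^sub>R cscale (- \<i>) H"
    and "cscale (\<i> * of_real s) H = s *\<^sub>R - cscale (- \<i>) H" for s
    by (simp_all add: cscale_def vec_eq_iff map_matrix_def scaleR_conv_of_real[where 'a = complex])
  then show ?thesis by (simp only: evolved_def flow_def)
qed

text \<open>The nonzero scalar -i factors out of the commutator, so vanishing for -iH and for H is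
  the same.\<close>

lemma evolved_invariant_iff:
  assumes "unitary_op W" and "t0 < t1"
  shows "(\<forall>t\<in>{t0..t1}. hat W (evolved H \<rho>0 t0 t) = evolved H \<rho>0 t0 t) \<longleftrightarrow>
    hat W \<rho>0 = \<rho>0 \<and> (\<forall>t\<in>{t0..t1}. commutator (H - hat W H) (evolved H \<rho>0 t0 t) = 0)"
  unfolding evolved_eq_flow flow_invariant_iff[OF assms]
  by (simp add: hat_cscale commutator_cscale cscale_eq_0_iff flip: cscale_diff)

section \<open>The frame change\<close>

lemma tensor_op_mult: "tensor_op A B ** tensor_op C D = tensor_op (A ** C) (B ** D)"
  by (simp add: tensor_op_def vec_eq_iff matrix_matrix_mult_def sum_product
      sum.cartesian_product mult_ac flip: UNIV_Times_UNIV)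
    (simp add: case_prod_beta mult_ac)

lemma dagger_tensor_op: "dagger (tensor_op A B) = tensor_op (dagger A) (dagger B)"
  by (simp add: dagger_def vec_eq_iff transpose_def map_matrix_def tensor_op_def)

lemma tensor_op_mat_1: "tensor_op (mat 1) (mat 1) = mat 1"
  by (auto simp: tensor_op_def vec_eq_iff mat_def)

lemma tensor_op_sum_left: "tensor_op (\<Sum>x\<in>S. f x) B = (\<Sum>x\<in>S. tensor_op (f x) B)"
  by (simp add: tensor_op_def vec_eq_iff sum_distrib_right)

lemma tensor_op_0_left [simp]: "tensor_op 0 B = 0"
  by (simp add: tensor_op_def vec_eq_iff)

lemma unitary_op_tensor_op:
  assumes "unitary_op Y" "unitary_op Z"
  shows "unitary_op (tensor_op Y Z)"
  using assms
  by (intro unitary_opI) (simp add: dagger_tensor_op tensor_op_mult tensor_op_mat_1 unitary_op_def)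

lemma ket_bra_mult: "ket_bra a b ** ket_bra c d = (if b = c then ket_bra a d else 0)"
  by (auto simp: ket_bra_def vec_eq_iff matrix_matrix_mult_def if_distrib[where f = "\<lambda>x. x * _"]
      sum.If_cases intro!: sum.neutral cong: if_cong)

lemma dagger_ket_bra: "dagger (ket_bra a b) = ket_bra b a"
  by (auto simp: dagger_def ket_bra_def vec_eq_iff transpose_def map_matrix_def)

lemma sum_ket_bra_diag: "(\<Sum>a\<in>UNIV. ket_bra a a) = mat 1"
  by (auto simp: ket_bra_def vec_eq_iff mat_def intro!: sum.neutral)

text \<open>Distinct g give orthogonal vectors |gi + g>, so only the diagonal of the double sum
  survives, and there the unitaries on the system cancel.\<close>

lemma unitary_frame_change:
  assumes "unitary_rep U"
  shows "unitary_op (frame_change U gi gj)"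
proof (rule unitary_opI)
  have U: "dagger (U g) ** U g = mat 1" for g
    using assms by (simp add: unitary_rep_def unitary_op_def)
  have "dagger (frame_change U gi gj) ** frame_change U gi gj =
      (\<Sum>g\<in>UNIV. \<Sum>h\<in>UNIV. if g = h
        then tensor_op (ket_bra (gj - g) (gj - h)) (dagger (U g) ** U h) else 0)"
    by (simp add: frame_change_def dagger_sum mm.sum_left mm.sum_right dagger_tensor_op
        dagger_ket_bra tensor_op_mult ket_bra_mult if_distrib[of "\<lambda>A. tensor_op A _"] cong: if_cong)
  also have "\<dots> = (\<Sum>g\<in>UNIV. tensor_op (ket_bra (gj - g) (gj - g)) (mat 1))"
    by (simp add: U)
  also have "\<dots> = tensor_op (\<Sum>g\<in>UNIV. ket_bra (gj - g) (gj - g)) (mat 1)"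
    by (simp add: tensor_op_sum_left)
  \<comment> \<open>The map sending g to gj - g is an involution of the group.\<close>
  also have "(\<Sum>g\<in>UNIV. ket_bra (gj - g) (gj - g)) = (\<Sum>a\<in>UNIV. ket_bra a a)"
    by (rule sum.reindex_bij_witness[of _ "\<lambda>a. gj - a" "\<lambda>a. gj - a"]) auto
  finally show "dagger (frame_change U gi gj) ** frame_change U gi gj = mat 1"
    by (simp add: sum_ket_bra_diag tensor_op_mat_1)
qed

text \<open>\<open>hat X\<close> and \<open>hat_dag X\<close> are mutually inverse, so
  \<open>X\<close> can be moved to the other side of the defining equation.\<close>

lemma subalg_iff:
  assumes "unitary_op X"
  shows "f \<in> subalg U gi gj X \<longleftrightarrow> hat (X ** frame_change U gi gj) f = f"
proof -
  have X: "dagger X ** X = mat 1" "X ** dagger X = mat 1"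
    using assms by (simp_all add: unitary_op_def)
  have "hat X (hat_dag X f) = f" for f
  proof -
    have "hat X (hat_dag X f) = (X ** dagger X) ** f ** (X ** dagger X)"
      by (simp only: hat_def hat_dag_def matrix_mul_assoc)
    then show ?thesis by (simp add: X)
  qed
  moreover have "hat_dag X (hat X f) = f" for f
  proof -
    have "hat_dag X (hat X f) = (dagger X ** X) ** f ** (dagger X ** X)"
      by (simp only: hat_def hat_dag_def matrix_mul_assoc)
    then show ?thesis by (simp add: X)
  qed
  ultimately show ?thesis
    unfolding subalg_def hat_hat[symmetric] by auto metis
qed

section \<open>The Hilbert--Schmidt projection\<close>

lemma hs_inner_eq_sum: "hs_inner A B = (\<Sum>i\<in>UNIV. \<Sum>j\<in>UNIV. cnj (A $ j $ i) * B $ j $ i)"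
  by (simp add: hs_inner_def trace_def matrix_matrix_mult_def dagger_def transpose_def map_matrix_def)

lemma hs_inner_self_eq_0_iff: "hs_inner A A = 0 \<longleftrightarrow> A = 0"
proof -
  have "hs_inner A A = of_real (\<Sum>i\<in>UNIV. \<Sum>j\<in>UNIV. (cmod (A $ j $ i))\<^sup>2)"
    by (simp add: hs_inner_eq_sum complex_norm_square mult.commute flip: of_real_power)
  then have "hs_inner A A = 0 \<longleftrightarrow> (\<forall>i j. A $ j $ i = 0)"
    by (simp only: of_real_eq_0_iff) (simp add: sum_nonneg_eq_0_iff sum_nonneg)
  then show ?thesis by (auto simp: vec_eq_iff)
qed

lemma hs_inner_diff_right: "hs_inner A (B - C) = hs_inner A B - hs_inner A C"
  by (simp add: hs_inner_eq_sum algebra_simps sum_subtractf)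

text \<open>Conjugation by a unitary is multiplicative and respects daggers, and the trace is
  cyclic.\<close>

lemma hs_inner_hat:
  assumes "unitary_op W"
  shows "hs_inner (hat W A) (hat W B) = hs_inner A B"
proof -
  have W: "dagger W ** W = mat 1"
    using assms by (simp add: unitary_op_def)
  have "dagger (hat W A) ** hat W B = hat W (dagger A ** B)"
    unfolding hat_mult[OF assms] by (simp add: hat_def dagger_mult matrix_mul_assoc)
  then have "hs_inner (hat W A) (hat W B) = trace ((W ** (dagger A ** B)) ** dagger W)"
    by (simp add: hs_inner_def hat_def)
  also have "\<dots> = trace (dagger W ** (W ** (dagger A ** B)))"
    by (rule trace_mul_sym)
  also have "\<dots> = trace ((dagger W ** W) ** (dagger A ** B))"
    by (simp only: matrix_mul_assoc)
  finally show ?thesis by (simp add: W hs_inner_def)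
qed

text \<open>The description in \<open>hs_proj\<close> needs uniqueness: a candidate \<open>p\<close>
  in \<open>S\<close> is orthogonal to both \<open>f\<close> and \<open>f - p\<close>, hence to
  itself.\<close>

lemma hs_proj_eq_0:
  assumes "0 \<in> S" and orth: "\<And>a. a \<in> S \<Longrightarrow> hs_inner a f = 0"
  shows "hs_proj S f = 0"
  unfolding hs_proj_def
proof (rule the_equality)
  fix p assume p: "p \<in> S \<and> (\<forall>a\<in>S. hs_inner a (f - p) = 0)"
  then have "hs_inner p p = 0"
    using orth[of p] by (auto simp: hs_inner_diff_right)
  then show "p = 0" by (simp add: hs_inner_self_eq_0_iff)
qed (use assms in auto)

text \<open>The subalgebra is the fixed space of the Hilbert--Schmidt isometry \<open>hat W\<close> with
  \<open>W = X ** frame_change U gi gj\<close>, hence orthogonal to the range of \<open>id - hat W\<close>. So the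
  projection onto the complement does not change \<open>H - imported U gi gj X H\<close> at all.\<close>

lemma proj_perp_imported:
  assumes "unitary_rep U" and "unitary_op X"
  shows "proj_perp U gi gj X (H - imported U gi gj X H) = H - imported U gi gj X H"
proof -
  let ?W = "X ** frame_change U gi gj"
  have W: "unitary_op ?W"
    by (intro unitary_op_mult unitary_frame_change assms)
  have "hs_proj (subalg U gi gj X) (H - imported U gi gj X H) = 0"
  proof (rule hs_proj_eq_0)
    show "0 \<in> subalg U gi gj X"
      by (simp add: subalg_iff[OF assms(2)] linear_0[OF bounded_linear.linear[OF bounded_linear_hat]])
    fix a assume "a \<in> subalg U gi gj X"
    then have "hat ?W a = a" by (simp add: subalg_iff[OF assms(2)])
    \<comment> \<open>The isometry applied to the pair \<open>a\<close>, \<open>H\<close>, with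
      \<open>a\<close> fixed.\<close>
    then have "hs_inner a (hat ?W H) = hs_inner a H"
      using hs_inner_hat[OF W, of a H] by simp
    then show "hs_inner a (H - imported U gi gj X H) = 0"
      by (simp add: hs_inner_diff_right imported_def hat_hat)
  qed
  then show ?thesis by (simp add: proj_perp_def proj_subalg_def)
qed

theorem lemma7:
  fixes U :: "'g::{finite, ab_group_add} \<Rightarrow> 's::finite op"
    and gi gj :: 'g
    and X H \<rho>0 :: "('g \<times> 's) op"
    and t0 t1 :: real
  assumes "(UNIV :: 'g set) \<noteq> {0}"
    and "unitary_rep U"
    and "bilocal_unitary X"
    and "self_adjoint H"
    and "density_op \<rho>0"
    and "t0 < t1"
  shows "((\<forall>t\<in>{t0..t1}. evolved H \<rho>0 t0 t \<in> subalg U gi gj X) \<longleftrightarrow>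
            \<rho>0 \<in> subalg U gi gj X \<and>
            (\<forall>t\<in>{t0..t1}. commutator (H - imported U gi gj X H) (evolved H \<rho>0 t0 t) = 0)) \<and>
         ((\<forall>t\<in>{t0..t1}. commutator (H - imported U gi gj X H) (evolved H \<rho>0 t0 t) = 0) \<longleftrightarrow>
          (\<forall>t\<in>{t0..t1}.
             commutator (proj_perp U gi gj X (H - imported U gi gj X H)) (evolved H \<rho>0 t0 t) = 0))"
proof -
  have X: "unitary_op X"
    using \<open>bilocal_unitary X\<close> by (auto simp: bilocal_unitary_def unitary_op_tensor_op)
  have "unitary_op (X ** frame_change U gi gj)"
    by (intro unitary_op_mult X unitary_frame_change \<open>unitary_rep U\<close>)
  from evolved_invariant_iff[OF this \<open>t0 < t1\<close>] show ?thesis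
    \<comment> \<open>After this rewriting both sides of the second equivalence coincide.\<close>
    unfolding proj_perp_imported[OF \<open>unitary_rep U\<close> X]
    unfolding subalg_iff[OF X] imported_def hat_hat
    by blast
qed

end
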